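(* Let $a=(a_1,\dots,a_n)$ and $b=(b_1,\dots,b_m)$ be probability vectors with positive entries and let $C=(c_{ij})\in\mathbb{R}_{\ge 0}^{n\times m}$. Fix $\varepsilon>0$. For $\lambda>0$ let $\Gamma^{\varepsilon,\lambda}$ be the unique minimizer of the entropic partial optimal transport problem, and let $\Gamma^{\varepsilon,\lambda}|_{\mathcal X\times\mathcal Y}=(\Gamma^{\varepsilon,\lambda}_{ij})_{1\le i\le n,\,1\le j\le m}$ be its upper-left $n\times m$ block. Let $\omega^{\varepsilon}$ be the unique minimizer of the balanced entropic optimal transport problem. Then $$\left\|\Gamma^{\varepsilon,\lambda}|_{\mathcal X\times\mathcal Y}-\omega^{\varepsilon}\right\|_{\ell^1}\to 0\qquad\text{as }\lambda\to\infty.$$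
   Context: For nonnegative vectors $r,s$ of equal total mass, $\Pi(r,s)$ is the set of nonnegative matrices with row sums $r$ and column sums $s$. Here $\mathcal X=\{1,\dots,n\}$, $\mathcal Y=\{1,\dots,m\}$, and $\|A\|_{\ell^1}=\sum_{i,j}|A_{ij}|$. The extended marginals are $\widetilde a=(a_1,\dots,a_n,1)$ and $\widetilde b=(b_1,\dots,b_m,1)$. The extended cost matrix has entries $\widetilde c^{\lambda}_{ij}=c_{ij}-2\lambda$ if $1\le i\le n$ and $1\le j\le m$, and $\widetilde c^{\lambda}_{ij}=0$ otherwise (for $1\le i\le n+1$, $1\le j\le m+1$). For a nonnegative matrix $A$, $E(A)=\sum_{i,j}A_{ij}(\log A_{ij}-1)$, with $0\log 0=0$. The entropic partial optimal transport problem is $$\min_{\Gamma\in\Pi(\widetilde a,\widetilde b)}\left\{\sum_{i=1}^{n+1}\sum_{j=1}^{m+1}\widetilde c^{\lambda}_{ij}\Gamma_{ij}+\varepsilon E(\Gamma)+2\lambda\right\},$$ and the balanced entropic optimal transport problem is $$\min_{\omega\in\Pi(a,b)}\left\{\sum_{i=1}^{n}\sum_{j=1}^{m}c_{ij}\omega_{ij}+\varepsilon E(\omega)\right\}.$$ Both have unique minimizers. *)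

theory Defs
  imports "HOL-Analysis.Analysis"
begin

text \<open>The index sets \<open>{1..n}\<close> and \<open>{1..m}\<close> are finite types \<open>'n\<close> and \<open>'m\<close>; an \<open>n \<times> m\<close> matrix has
  type \<open>real ^ 'm ^ 'n\<close>. The extended index set \<open>{1..n+1}\<close> is \<open>'n option\<close>, where \<open>None\<close> plays the
  role of the additional index \<open>n+1\<close>.\<close>

definition couplings :: "real ^ 'n \<Rightarrow> real ^ 'm \<Rightarrow> (real ^ 'm ^ 'n) set" where
  "couplings r s = {A. (\<forall>i j. 0 \<le> A $ i $ j) \<and>
                       (\<forall>i. (\<Sum>j\<in>UNIV. A $ i $ j) = r $ i) \<and>
                       (\<forall>j. (\<Sum>i\<in>UNIV. A $ i $ j) = s $ j)}"

definition l1_norm :: "real ^ 'm ^ 'n \<Rightarrow> real" where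
  "l1_norm A = (\<Sum>i\<in>UNIV. \<Sum>j\<in>UNIV. \<bar>A $ i $ j\<bar>)"

text \<open>Only used on nonnegative matrices; the convention \<open>0 log 0 = 0\<close> holds because of the
  factor \<open>A $ i $ j\<close>.\<close>

definition entropy :: "real ^ 'm ^ 'n \<Rightarrow> real" where
  "entropy A = (\<Sum>i\<in>UNIV. \<Sum>j\<in>UNIV. A $ i $ j * (ln (A $ i $ j) - 1))"

definition transport_cost :: "real ^ 'm ^ 'n \<Rightarrow> real ^ 'm ^ 'n \<Rightarrow> real" where
  "transport_cost c A = (\<Sum>i\<in>UNIV. \<Sum>j\<in>UNIV. c $ i $ j * A $ i $ j)"

definition extend_marginal :: "real ^ 'n \<Rightarrow> real ^ 'n option" where
  "extend_marginal a = (\<chi> i. case i of Some k \<Rightarrow> a $ k | None \<Rightarrow> 1)"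

definition extend_cost :: "real \<Rightarrow> real ^ 'm ^ 'n \<Rightarrow> real ^ 'm option ^ 'n option" where
  "extend_cost l c =
     (\<chi> i j. case (i, j) of (Some k, Some k') \<Rightarrow> c $ k $ k' - 2 * l | _ \<Rightarrow> 0)"

definition upper_left_block :: "real ^ 'm option ^ 'n option \<Rightarrow> real ^ 'm ^ 'n" where
  "upper_left_block G = (\<chi> i j. G $ Some i $ Some j)"

definition the_minimizer :: "('x \<Rightarrow> real) \<Rightarrow> 'x set \<Rightarrow> 'x" where
  "the_minimizer f S = (THE x. is_arg_min f (\<lambda>x. x \<in> S) x)"

definition entropic_partial_plan ::
  "real \<Rightarrow> real \<Rightarrow> real ^ 'm ^ 'n \<Rightarrow> real ^ 'n \<Rightarrow> real ^ 'm \<Rightarrow> real ^ 'm option ^ 'n option" where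
  "entropic_partial_plan \<epsilon> l c a b =
     the_minimizer (\<lambda>G. transport_cost (extend_cost l c) G + \<epsilon> * entropy G + 2 * l)
       (couplings (extend_marginal a) (extend_marginal b))"

definition entropic_balanced_plan ::
  "real \<Rightarrow> real ^ 'm ^ 'n \<Rightarrow> real ^ 'n \<Rightarrow> real ^ 'm \<Rightarrow> real ^ 'm ^ 'n" where
  "entropic_balanced_plan \<epsilon> c a b =
     the_minimizer (\<lambda>w. transport_cost c w + \<epsilon> * entropy w) (couplings a b)"

end

theory Submission
  imports Defs "HOL-Real_Asymp.Real_Asymp"
begin

text \<open>On \<open>\<Pi>(\<widetilde>a, \<widetilde>b)\<close> the objective equals \<open>g(\<Gamma>) + 2 \<lambda> h(\<Gamma>)\<close>, where \<open>g\<close> does not depend on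
  \<open>\<lambda>\<close> and \<open>h(\<Gamma>) = \<Sum>\<^sub>i \<Gamma>\<^sub>i\<^sub>,\<^sub>n\<^sub>+\<^sub>1 \<ge> 0\<close> is the mass that is not transported. The plans with
  \<open>h(\<Gamma>) = 0\<close> are the block matrices \<open>diag(\<omega>, 1)\<close> with \<open>\<omega> \<in> \<Pi>(a, b)\<close>, and there \<open>g\<close> is the balanced
  objective shifted by \<open>-\<epsilon>\<close>. So \<open>\<lambda>\<close> acts as a penalty parameter, and compactness together with
  uniqueness of \<open>\<omega>\<^sup>\<epsilon>\<close> gives \<open>\<Gamma>\<^sup>\<epsilon> \<longlongrightarrow> diag(\<omega>\<^sup>\<epsilon>, 1)\<close>.\<close>

section \<open>Convergence of minimizers under a growing penalty\<close>

text \<open>Outside a ball around \<open>z\<close>, compactness yields one weight \<open>N\<close>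
  at which every point is already worse than \<open>z\<close>. Since \<open>h\<close> is nonnegative
  on \<open>K\<close>, this persists for larger weights, so for \<open>l \<ge> N\<close> the
  minimizer \<open>X l\<close> must lie in the ball.\<close>

lemma penalty_method_tendsto:
  fixes g h :: "'a::metric_space \<Rightarrow> real" and X :: "real \<Rightarrow> 'a"
  assumes K: "compact K" and g: "continuous_on K g" and h: "continuous_on K h"
    and h_nonneg: "\<And>x. x \<in> K \<Longrightarrow> 0 \<le> h x"
    and z: "z \<in> K" "h z = 0"
    and z_min: "\<And>x. x \<in> K \<Longrightarrow> h x = 0 \<Longrightarrow> x \<noteq> z \<Longrightarrow> g z < g x"
    and X: "\<And>l. X l \<in> K" "\<And>l x. x \<in> K \<Longrightarrow> g (X l) + l * h (X l) \<le> g x + l * h x"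
  shows "(X \<longlongrightarrow> z) at_top"
proof (rule tendstoI)
  fix e :: real assume "0 < e"
  define K' where "K' = K - ball z e"
  have K': "compact K'" unfolding K'_def using K by (intro compact_diff) auto
  have K'_sub: "K' \<subseteq> K" by (auto simp: K'_def)
  \<comment> \<open>If no weight worked, the violating points for N = 0, 1, 2, ... would have a
    cluster point \<open>w\<close> in \<open>K'\<close>. The bound
    \<open>g w + real N * h w \<le> g z\<close> for all \<open>N\<close> then forces
    \<open>h w = 0\<close> and \<open>g w \<le> g z\<close>, against \<open>z_min\<close>.\<close>
  have "\<exists>N. \<forall>x\<in>K'. g z < g x + real N * h x"
  proof (rule ccontr)
    assume "\<nexists>N. \<forall>x\<in>K'. g z < g x + real N * h x"
    then obtain y where y: "\<And>N. y N \<in> K'" "\<And>N. g (y N) + real N * h (y N) \<le> g z"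
      by (metis not_le)
    obtain w r where w: "w \<in> K'" and r: "strict_mono r" and lim: "(y \<circ> r) \<longlonglongrightarrow> w"
      using K' y(1) unfolding compact_def by metis
    have "(y \<circ> r) n \<in> K" for n using y(1) K'_sub by auto
    then have in_K: "w \<in> K" "\<forall>\<^sub>F n in sequentially. (y \<circ> r) n \<in> K"
      using w K'_sub by (blast, simp)
    have lim_g: "(\<lambda>n. g (y (r n))) \<longlonglongrightarrow> g w" and lim_h: "(\<lambda>n. h (y (r n))) \<longlonglongrightarrow> h w"
      using continuous_on_tendsto_compose[OF g lim in_K] continuous_on_tendsto_compose[OF h lim in_K]
      by simp_all
    \<comment> \<open>A violation at weight \<open>r n\<close> is also one at every smaller weight,
      so \<open>N\<close> can stay fixed while \<open>n\<close> tends to infinity.\<close>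
    have N: "g (y (r n)) + real N * h (y (r n)) \<le> g z" if "N \<le> n" for N n
    proof -
      have "N \<le> r n" using seq_suble[OF r, of n] that by linarith
      then have "real N * h (y (r n)) \<le> real (r n) * h (y (r n))"
        using h_nonneg y(1) K'_sub by (intro mult_right_mono) auto
      then show ?thesis using y(2)[of "r n"] by linarith
    qed
    have le: "g w + real N * h w \<le> g z" for N
      by (rule tendsto_upperbound[of "\<lambda>n. g (y (r n)) + real N * h (y (r n))" _ sequentially])
        (auto intro!: tendsto_intros lim_g lim_h eventually_sequentiallyI[of N] N)
    have "h w = 0"
    proof (rule ccontr)
      assume "h w \<noteq> 0"
      then have pos: "0 < h w" using h_nonneg[of w] w K'_sub by force
      obtain N where "(g z - g w) / h w < real N" using reals_Archimedean2 by blast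
      then show False using le[of N] pos by (simp add: field_simps)
    qed
    moreover have "w \<noteq> z" using w \<open>0 < e\<close> by (auto simp: K'_def)
    ultimately show False using z_min[of w] le[of 0] w K'_sub by force
  qed
  then obtain N where N: "\<And>x. x \<in> K' \<Longrightarrow> g z < g x + real N * h x" by blast
  show "\<forall>\<^sub>F l in at_top. dist (X l) z < e"
    using eventually_ge_at_top[of "real N"]
  proof eventually_elim
    case (elim l)
    have "real N * h (X l) \<le> l * h (X l)"
      using elim h_nonneg X(1) by (intro mult_right_mono) auto
    \<comment> \<open>Comparison of \<open>X l\<close> with \<open>z\<close>, whose penalty
      vanishes.\<close>
    then have "g (X l) + real N * h (X l) \<le> g z" using X(2)[OF z(1), of l] z(2) by simp
    then have "X l \<notin> K'" using N[of "X l"] by force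
    then show ?case using X(1) by (auto simp: K'_def dist_commute)
  qed
qed

section \<open>Unique minimizers from strict midpoint convexity\<close>

text \<open>Compactness gives a minimizer; a second point with the same value would, by
  \<open>mid\<close>, produce a value below the minimum. Uniqueness is what gives the
  \<open>THE\<close> in \<open>the_minimizer\<close> a meaning.\<close>

lemma the_minimizer_unique:
  fixes f :: "'a::topological_space \<Rightarrow> real"
  assumes "compact S" "S \<noteq> {}" "continuous_on S f"
    and mid: "\<And>x y. x \<in> S \<Longrightarrow> y \<in> S \<Longrightarrow> x \<noteq> y \<Longrightarrow> \<exists>z\<in>S. 2 * f z < f x + f y"
  shows "the_minimizer f S \<in> S"
    and "\<And>y. y \<in> S \<Longrightarrow> y \<noteq> the_minimizer f S \<Longrightarrow> f (the_minimizer f S) < f y"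
proof -
  obtain x where x: "x \<in> S" "\<And>y. y \<in> S \<Longrightarrow> f x \<le> f y"
    using continuous_attains_inf[OF assms(1-3)] by blast
  have uniq: "f x < f y" if y: "y \<in> S" "y \<noteq> x" for y
  proof -
    obtain z where "z \<in> S" "2 * f z < f x + f y" using mid[OF x(1) y(1)] y(2) by blast
    then show ?thesis using x(2)[of z] by linarith
  qed
  have min: "is_arg_min f (\<lambda>x. x \<in> S) x" using x by (auto simp: is_arg_min_def not_less)
  have eq: "the_minimizer f S = x"
    unfolding the_minimizer_def
    by (rule the_equality, rule min) (use uniq x(1) in \<open>auto simp: is_arg_min_def\<close>)
  show "the_minimizer f S \<in> S" using x(1) eq by simp
  show "\<And>y. y \<in> S \<Longrightarrow> y \<noteq> the_minimizer f S \<Longrightarrow> f (the_minimizer f S) < f y"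
    using uniq eq by simp
qed

section \<open>Continuity of x ln x and strict convexity of the entropy\<close>

text \<open>The boundary point 0 is the delicate one: there the value is 0 because of the factor
  \<open>x\<close>, and it agrees with the limit from the right.\<close>

lemma continuous_on_x_ln_x: "continuous_on {0..} (\<lambda>x::real. x * ln x)"
  unfolding continuous_on_def
proof
  fix x :: real assume "x \<in> {0..}"
  show "((\<lambda>x. x * ln x) \<longlongrightarrow> x * ln x) (at x within {0..})"
  proof (cases "x = 0")
    case True
    have "((\<lambda>x::real. x * ln x) \<longlongrightarrow> 0) (at_right 0)" by real_asymp
    then show ?thesis using True by (simp add: at_within_Ici_at_right)
  next
    case False
    then have "isCont (\<lambda>x. x * ln x) x" by (intro continuous_intros) auto
    then show ?thesis unfolding isCont_def by (rule tendsto_within_subset) simp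
  qed
qed

text \<open>From \<open>ln z \<le> z - 1\<close> at \<open>z = t / x\<close>, where equality holds only for \<open>x = t\<close>.\<close>

lemma x_ln_tangent:
  fixes x t :: real
  assumes "0 \<le> x" "0 < t"
  shows "x * ln t - x * ln x \<le> t - x"
    and "x \<noteq> t \<Longrightarrow> x * ln t - x * ln x < t - x"
proof -
  show strict: "x * ln t - x * ln x < t - x" if "x \<noteq> t"
  proof (cases "x = 0")
    case False
    then have "0 < x" using assms by simp
    have "ln (t / x) < t / x - 1"
      using ln_le_minus_one[of "t / x"] ln_eq_minus_one[of "t / x"] that \<open>0 < x\<close> assms(2)
      by fastforce
    then have "x * ln (t / x) < x * (t / x - 1)" using \<open>0 < x\<close> by simp
    then show ?thesis using \<open>0 < x\<close> assms(2) by (simp add: ln_div algebra_simps)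
  qed (use assms in simp)
  show "x * ln t - x * ln x \<le> t - x" using strict by (cases "x = t") auto
qed

text \<open>Add the tangent inequalities of \<open>x\<close> and of \<open>y\<close> at their
  midpoint \<open>t\<close>: the right-hand sides cancel because
  \<open>t + t = x + y\<close>.\<close>

lemma x_ln_midpoint:
  fixes x y :: real
  assumes "0 \<le> x" "0 \<le> y"
  defines "t \<equiv> (x + y) / 2"
  shows "2 * (t * (ln t - 1)) \<le> x * (ln x - 1) + y * (ln y - 1)"
    and "x \<noteq> y \<Longrightarrow> 2 * (t * (ln t - 1)) < x * (ln x - 1) + y * (ln y - 1)"
proof -
  have eq: "2 * (t * (ln t - 1)) = x * ln t + y * ln t - x - y"
    by (simp add: t_def field_simps)
  show strict: "2 * (t * (ln t - 1)) < x * (ln x - 1) + y * (ln y - 1)" if "x \<noteq> y"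
  proof -
    \<comment> \<open>Distinct nonnegative numbers have a positive midpoint even if one of them is
      0, so the tangent at \<open>t\<close> exists.\<close>
    have "0 < t" "x \<noteq> t" using assms(1,2) that by (auto simp: t_def)
    then have "x * ln t - x * ln x < t - x" "y * ln t - y * ln y \<le> t - y"
      using assms(1,2) x_ln_tangent by auto
    moreover have "t + t = x + y" by (simp add: t_def)
    ultimately show ?thesis unfolding eq by (simp add: algebra_simps)
  qed
  show "2 * (t * (ln t - 1)) \<le> x * (ln x - 1) + y * (ln y - 1)"
    using strict by (cases "x = y") (auto simp: t_def)
qed

text \<open>The scalar inequality is summed over all entries; a single entry where \<open>A\<close>
  and \<open>B\<close> differ makes its row sum, and hence the total, strict.\<close>

lemma entropy_midpoint:
  fixes A B :: "real ^ 'm::finite ^ 'n::finite"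
  assumes nonneg: "\<And>i j. 0 \<le> A $ i $ j" "\<And>i j. 0 \<le> B $ i $ j" and "A \<noteq> B"
  shows "2 * entropy ((1 / 2) *\<^sub>R (A + B)) < entropy A + entropy B"
proof -
  let ?\<phi> = "\<lambda>x::real. x * (ln x - 1)"
  have le: "2 * ?\<phi> (((1 / 2) *\<^sub>R (A + B)) $ i $ j) \<le> ?\<phi> (A $ i $ j) + ?\<phi> (B $ i $ j)" for i j
    using x_ln_midpoint(1)[OF nonneg, of i j i j] by simp
  obtain i j where "A $ i $ j \<noteq> B $ i $ j" using \<open>A \<noteq> B\<close> by (auto simp: vec_eq_iff)
  then have less: "2 * ?\<phi> (((1 / 2) *\<^sub>R (A + B)) $ i $ j) < ?\<phi> (A $ i $ j) + ?\<phi> (B $ i $ j)"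
    using x_ln_midpoint(2)[OF nonneg, of i j i j] by simp
  have "(\<Sum>i\<in>UNIV. \<Sum>j\<in>UNIV. 2 * ?\<phi> (((1 / 2) *\<^sub>R (A + B)) $ i $ j))
      < (\<Sum>i\<in>UNIV. \<Sum>j\<in>UNIV. ?\<phi> (A $ i $ j) + ?\<phi> (B $ i $ j))"
  proof (rule sum_strict_mono_ex1)
    show "\<exists>i\<in>UNIV. (\<Sum>j\<in>UNIV. 2 * ?\<phi> (((1 / 2) *\<^sub>R (A + B)) $ i $ j))
        < (\<Sum>j\<in>UNIV. ?\<phi> (A $ i $ j) + ?\<phi> (B $ i $ j))"
      by (rule bexI[of _ i], rule sum_strict_mono_ex1) (use le less in auto)
  qed (use le in \<open>auto intro!: sum_mono\<close>)
  then show ?thesis by (simp only: entropy_def sum.distrib sum_distrib_left)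
qed

section \<open>Couplings and the entropic problem over them\<close>

text \<open>The constraints are closed conditions, and nonnegativity bounds the norm by the sum of
  all entries, which is the total mass of \<open>r\<close>.\<close>

lemma compact_couplings:
  fixes r :: "real ^ 'n::finite" and s :: "real ^ 'm::finite"
  shows "compact (couplings r s)"
proof (rule compact_eq_bounded_closed[THEN iffD2], intro conjI)
  have "norm A \<le> (\<Sum>i\<in>UNIV. r $ i)" if A: "A \<in> couplings r s" for A
  proof -
    have "norm A \<le> (\<Sum>i\<in>UNIV. norm (A $ i))"
      unfolding norm_vec_def by (rule L2_set_le_sum) auto
    also have "\<dots> \<le> (\<Sum>i\<in>UNIV. \<Sum>j\<in>UNIV. \<bar>A $ i $ j\<bar>)"
      by (intro sum_mono norm_le_l1_cart)
    also have "\<dots> = (\<Sum>i\<in>UNIV. r $ i)" using A by (simp add: couplings_def)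
    finally show ?thesis .
  qed
  then show "bounded (couplings r s)" unfolding bounded_iff by blast
  show "closed (couplings r s)"
    unfolding couplings_def
    by (intro closed_Collect_conj closed_Collect_all closed_Collect_le closed_Collect_eq
        continuous_intros)
qed

lemma midpoint_in_couplings:
  assumes "A \<in> couplings r s" "B \<in> couplings r s"
  shows "(1 / 2) *\<^sub>R (A + B) \<in> couplings r s"
  using assms unfolding couplings_def
  by (auto simp: sum.distrib add_divide_distrib simp flip: sum_divide_distrib)

lemma continuous_on_transport_cost: "continuous_on S (transport_cost c)"
  unfolding transport_cost_def by (intro continuous_intros)

lemma continuous_on_entropy_couplings: "continuous_on (couplings r s) entropy"
proof -
  have "continuous_on (couplings r s) (\<lambda>A. A $ i $ j * ln (A $ i $ j))" for i j
    by (rule continuous_on_compose2[OF continuous_on_x_ln_x])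
      (auto intro!: continuous_intros simp: couplings_def)
  then show ?thesis unfolding entropy_def right_diff_distrib
    by (intro continuous_on_sum continuous_on_diff) (simp_all add: continuous_on_component)
qed

lemma transport_cost_midpoint:
  "2 * transport_cost c ((1 / 2) *\<^sub>R (A + B)) = transport_cost c A + transport_cost c B"
  unfolding transport_cost_def sum_distrib_left sum.distrib[symmetric]
  by (simp add: algebra_simps)

text \<open>The cost is linear and the entropy strictly midpoint convex, so
  \<open>\<epsilon> > 0\<close> gives strictness. The constant \<open>k\<close> lets the result
  serve both the partial problem (\<open>k = 2 * l\<close>) and the balanced one
  (\<open>k = 0\<close>).\<close>

lemma entropic_minimizer:
  fixes c :: "real ^ 'm::finite ^ 'n::finite" and k :: real
  assumes "0 < \<epsilon>" "couplings r s \<noteq> {}"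
  defines "f \<equiv> \<lambda>A. transport_cost c A + \<epsilon> * entropy A + k"
  shows "the_minimizer f (couplings r s) \<in> couplings r s"
    and "A \<in> couplings r s \<Longrightarrow> A \<noteq> the_minimizer f (couplings r s) \<Longrightarrow>
      f (the_minimizer f (couplings r s)) < f A"
proof -
  have cont: "continuous_on (couplings r s) f"
    unfolding f_def
    by (intro continuous_intros continuous_on_transport_cost continuous_on_entropy_couplings)
  have mid: "\<exists>Z\<in>couplings r s. 2 * f Z < f A + f B"
    if "A \<in> couplings r s" "B \<in> couplings r s" "A \<noteq> B" for A B
  proof (rule bexI)
    have "2 * entropy ((1 / 2) *\<^sub>R (A + B)) < entropy A + entropy B"
      using that by (intro entropy_midpoint) (auto simp: couplings_def)
    then have "\<epsilon> * (2 * entropy ((1 / 2) *\<^sub>R (A + B))) < \<epsilon> * (entropy A + entropy B)"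
      using \<open>0 < \<epsilon>\<close> by simp
    then show "2 * f ((1 / 2) *\<^sub>R (A + B)) < f A + f B"
      using transport_cost_midpoint[of c A B] unfolding f_def by (simp add: algebra_simps)
  qed (rule midpoint_in_couplings[OF that(1,2)])
  note * = the_minimizer_unique[OF compact_couplings assms(2) cont mid]
  show "the_minimizer f (couplings r s) \<in> couplings r s"
    using *(1) .
  show "A \<in> couplings r s \<Longrightarrow> A \<noteq> the_minimizer f (couplings r s) \<Longrightarrow>
      f (the_minimizer f (couplings r s)) < f A"
    using *(2) .
qed

lemma couplings_nonempty:
  fixes a :: "real ^ 'n::finite" and b :: "real ^ 'm::finite"
  assumes "\<And>i. 0 \<le> a $ i" "(\<Sum>i\<in>UNIV. a $ i) = 1" "\<And>j. 0 \<le> b $ j" "(\<Sum>j\<in>UNIV. b $ j) = 1"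
  shows "couplings a b \<noteq> {}"
proof -
  \<comment> \<open>The independent (product) coupling.\<close>
  have "(\<chi> i j. a $ i * b $ j) \<in> couplings a b"
    using assms by (simp add: couplings_def flip: sum_distrib_left sum_distrib_right)
  then show ?thesis by blast
qed

section \<open>Block diagonal plans and untransported mass\<close>

lemma sum_UNIV_option:
  fixes f :: "'a::finite option \<Rightarrow> 'b::comm_monoid_add"
  shows "(\<Sum>i\<in>UNIV. f i) = f None + (\<Sum>i\<in>UNIV. f (Some i))"
  by (simp add: UNIV_option_conv sum.reindex)

definition extend_plan :: "real ^ 'm ^ 'n \<Rightarrow> real ^ 'm option ^ 'n option" where
  "extend_plan w = (\<chi> i j. case (i, j) of (Some k, Some k') \<Rightarrow> w $ k $ k'
     | (None, None) \<Rightarrow> 1 | _ \<Rightarrow> 0)"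

lemma extend_plan_nth [simp]:
  "extend_plan w $ Some i $ Some j = w $ i $ j"
  "extend_plan w $ Some i $ None = 0"
  "extend_plan w $ None $ Some j = 0"
  "extend_plan w $ None $ None = 1"
  by (simp_all add: extend_plan_def)

lemma extend_plan_in_couplings:
  fixes w :: "real ^ 'm::finite ^ 'n::finite"
  assumes "w \<in> couplings a b"
  shows "extend_plan w \<in> couplings (extend_marginal a) (extend_marginal b)"
proof -
  have "0 \<le> extend_plan w $ i $ j" for i j
    using assms by (cases i; cases j) (auto simp: couplings_def)
  moreover have "(\<Sum>j\<in>UNIV. extend_plan w $ i $ j) = extend_marginal a $ i" for i
    using assms by (cases i) (auto simp: couplings_def extend_marginal_def sum_UNIV_option)
  moreover have "(\<Sum>i\<in>UNIV. extend_plan w $ i $ j) = extend_marginal b $ j" for j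
    using assms by (cases j) (auto simp: couplings_def extend_marginal_def sum_UNIV_option)
  ultimately show ?thesis by (simp add: couplings_def)
qed

text \<open>The corner entry contributes \<open>1 * (ln 1 - 1) = -1\<close>; the zero entries
  contribute nothing.\<close>

lemma entropy_extend_plan:
  "entropy (extend_plan w) = entropy (w :: real ^ 'm::finite ^ 'n::finite) - 1"
  by (simp add: entropy_def sum_UNIV_option)

lemma transport_cost_extend_plan:
  fixes w :: "real ^ 'm::finite ^ 'n::finite"
  shows "transport_cost (extend_cost 0 c) (extend_plan w) = transport_cost c w"
  by (simp add: transport_cost_def extend_cost_def sum_UNIV_option)

definition slack :: "real ^ 'm::finite option ^ 'n::finite option \<Rightarrow> real" where
  "slack G = (\<Sum>i\<in>UNIV. G $ Some i $ None)"

lemma extended_couplingsD: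
  fixes a :: "real ^ 'n::finite" and b :: "real ^ 'm::finite"
  assumes "G \<in> couplings (extend_marginal a) (extend_marginal b)"
  shows "0 \<le> G $ i $ j"
    and "G $ Some k $ None + (\<Sum>j\<in>UNIV. G $ Some k $ Some j) = a $ k"
    and "G $ None $ Some k' + (\<Sum>i\<in>UNIV. G $ Some i $ Some k') = b $ k'"
    and "G $ None $ None + (\<Sum>i\<in>UNIV. G $ Some i $ None) = 1"
proof -
  have rows: "(\<Sum>j\<in>UNIV. G $ i $ j) = extend_marginal a $ i"
    and cols: "(\<Sum>i\<in>UNIV. G $ i $ j) = extend_marginal b $ j" for i j
    using assms by (auto simp: couplings_def)
  show "0 \<le> G $ i $ j" using assms by (simp add: couplings_def)
  show "G $ Some k $ None + (\<Sum>j\<in>UNIV. G $ Some k $ Some j) = a $ k"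
    using rows[of "Some k"] by (simp add: sum_UNIV_option extend_marginal_def)
  show "G $ None $ Some k' + (\<Sum>i\<in>UNIV. G $ Some i $ Some k') = b $ k'"
    using cols[of "Some k'"] by (simp add: sum_UNIV_option extend_marginal_def)
  show "G $ None $ None + (\<Sum>i\<in>UNIV. G $ Some i $ None) = 1"
    using cols[of None] by (simp add: sum_UNIV_option extend_marginal_def)
qed

lemma slack_nonneg:
  assumes "G \<in> couplings (extend_marginal a) (extend_marginal b)"
  shows "0 \<le> slack G"
  using extended_couplingsD(1)[OF assms] by (simp add: slack_def sum_nonneg)

text \<open>Sum the row constraints over the original rows, whose total mass is 1.\<close>

lemma block_mass:
  assumes "G \<in> couplings (extend_marginal a) (extend_marginal b)"
    and "(\<Sum>i\<in>UNIV. a $ i) = 1"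
  shows "(\<Sum>i\<in>UNIV. \<Sum>j\<in>UNIV. G $ Some i $ Some j) = 1 - slack G"
proof -
  have "slack G + (\<Sum>i\<in>UNIV. \<Sum>j\<in>UNIV. G $ Some i $ Some j) = 1"
    unfolding slack_def sum.distrib[symmetric] extended_couplingsD(2)[OF assms(1)] by fact
  then show ?thesis by simp
qed

text \<open>The discount \<open>2 * l\<close> is earned on the block mass
  \<open>1 - slack G\<close>; the additive \<open>2 * l\<close> cancels all of it but the penalty on
  the slack.\<close>

lemma extended_objective:
  assumes "G \<in> couplings (extend_marginal a) (extend_marginal b)"
    and "(\<Sum>i\<in>UNIV. a $ i) = 1"
  shows "transport_cost (extend_cost l c) G + 2 * l
    = transport_cost (extend_cost 0 c) G + 2 * l * slack G"
proof -
  have "transport_cost (extend_cost l c) G = transport_cost (extend_cost 0 c) G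
      - 2 * l * (\<Sum>i\<in>UNIV. \<Sum>j\<in>UNIV. G $ Some i $ Some j)"
    by (simp add: transport_cost_def extend_cost_def sum_UNIV_option left_diff_distrib
        sum_subtractf sum_distrib_left)
  then show ?thesis unfolding block_mass[OF assms] by (simp add: algebra_simps)
qed

text \<open>Zero slack kills the additional column, so the block carries mass 1. As \<open>b\<close>
  also has mass 1, nothing is left for the additional row, and the corner must be 1.\<close>

lemma slack_eq_0D:
  fixes a :: "real ^ 'n::finite" and b :: "real ^ 'm::finite"
  assumes G: "G \<in> couplings (extend_marginal a) (extend_marginal b)"
    and a: "(\<Sum>i\<in>UNIV. a $ i) = 1" and b: "(\<Sum>j\<in>UNIV. b $ j) = 1"
    and "slack G = 0"
  shows "upper_left_block G \<in> couplings a b" and "G = extend_plan (upper_left_block G)"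
proof -
  note D = extended_couplingsD[OF G]
  have col: "G $ Some i $ None = 0" for i
    using \<open>slack G = 0\<close> D(1) by (simp add: slack_def sum_nonneg_eq_0_iff)
  have "(\<Sum>j\<in>UNIV. G $ None $ Some j) + (\<Sum>j\<in>UNIV. \<Sum>i\<in>UNIV. G $ Some i $ Some j) = 1"
    unfolding sum.distrib[symmetric] D(3) by fact
  moreover have "(\<Sum>j\<in>UNIV. \<Sum>i\<in>UNIV. G $ Some i $ Some j) = 1"
    using block_mass[OF G a] \<open>slack G = 0\<close> by (subst sum.swap) simp
  ultimately have "(\<Sum>j\<in>UNIV. G $ None $ Some j) = 0" by simp
  then have row: "G $ None $ Some j = 0" for j
    using D(1) by (simp add: sum_nonneg_eq_0_iff)
  have corner: "G $ None $ None = 1" using D(4) col by simp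
  show "upper_left_block G \<in> couplings a b"
    using D(1) D(2,3) row col by (simp add: couplings_def upper_left_block_def)
  have "G $ i $ j = extend_plan (upper_left_block G) $ i $ j" for i j
    using row col corner by (cases i; cases j) (simp_all add: upper_left_block_def)
  then show "G = extend_plan (upper_left_block G)" by (simp add: vec_eq_iff)
qed

section \<open>Passage to the limit\<close>

theorem corollary3p6:
  fixes a :: "real ^ 'n::finite" and b :: "real ^ 'm::finite"
    and c :: "real ^ 'm ^ 'n" and \<epsilon> :: real
  assumes "\<And>i. 0 < a $ i" and "(\<Sum>i\<in>UNIV. a $ i) = 1"
    and "\<And>j. 0 < b $ j" and "(\<Sum>j\<in>UNIV. b $ j) = 1"
    and "\<And>i j. 0 \<le> c $ i $ j"
    and "0 < \<epsilon>"
  shows "((\<lambda>l. l1_norm (upper_left_block (entropic_partial_plan \<epsilon> l c a b)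
                          - entropic_balanced_plan \<epsilon> c a b)) \<longlongrightarrow> 0) at_top"
proof -
  define K where "K = couplings (extend_marginal a) (extend_marginal b)"
  define w where "w = entropic_balanced_plan \<epsilon> c a b"
  define P where "P = (\<lambda>l. entropic_partial_plan \<epsilon> l c a b)"
  define g where "g = (\<lambda>G. transport_cost (extend_cost 0 c) G + \<epsilon> * entropy G)"
  have ne: "couplings a b \<noteq> {}"
    using assms(1-4) by (intro couplings_nonempty) (auto intro: less_imp_le)
  then have neK: "K \<noteq> {}" using extend_plan_in_couplings K_def by blast
  have w: "w \<in> couplings a b"
    and w_min: "\<And>v. v \<in> couplings a b \<Longrightarrow> v \<noteq> w \<Longrightarrow>
      transport_cost c w + \<epsilon> * entropy w < transport_cost c v + \<epsilon> * entropy v"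
    using entropic_minimizer[OF assms(6) ne, where c = c and k = 0]
    by (simp_all add: w_def entropic_balanced_plan_def)
  \<comment> \<open>Valid for every real \<open>l\<close>, as the penalty lemma quantifies over all
    of them.\<close>
  have P: "P l \<in> K" for l
    using entropic_minimizer(1)[OF assms(6) neK[unfolded K_def]]
    by (simp add: P_def K_def entropic_partial_plan_def)
  have P_min: "g (P l) + l * (2 * slack (P l)) \<le> g G + l * (2 * slack G)" if "G \<in> K" for l G
  proof -
    have "transport_cost (extend_cost l c) (P l) + \<epsilon> * entropy (P l) + 2 * l
        \<le> transport_cost (extend_cost l c) G + \<epsilon> * entropy G + 2 * l"
      using entropic_minimizer(2)[OF assms(6) neK[unfolded K_def] that[unfolded K_def],
          where c = "extend_cost l c" and k = "2 * l"]
      by (cases "G = P l") (auto simp: P_def entropic_partial_plan_def)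
    then show ?thesis
      using extended_objective[OF P[unfolded K_def] assms(2), of l c l]
        extended_objective[OF that[unfolded K_def] assms(2), of l c]
      unfolding g_def by (simp add: algebra_simps)
  qed
  have "(P \<longlongrightarrow> extend_plan w) at_top"
  \<comment> \<open>The factor 2 is put into \<open>h\<close>, so that the penalty weight is exactly
    \<open>l\<close>.\<close>
  proof (rule penalty_method_tendsto[where K = K and g = g and h = "\<lambda>G. 2 * slack G"])
    show "compact K" unfolding K_def by (rule compact_couplings)
    show "continuous_on K g" unfolding g_def K_def
      by (intro continuous_intros continuous_on_transport_cost continuous_on_entropy_couplings)
    show "continuous_on K (\<lambda>G. 2 * slack G)" unfolding slack_def by (intro continuous_intros)
    show "0 \<le> 2 * slack G" if "G \<in> K" for G using slack_nonneg that by (auto simp: K_def)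
    show "extend_plan w \<in> K" using extend_plan_in_couplings[OF w] by (simp add: K_def)
    show "2 * slack (extend_plan w) = 0" by (simp add: slack_def)
    show "g (extend_plan w) < g G" if "G \<in> K" "2 * slack G = 0" "G \<noteq> extend_plan w" for G
    proof -
      have eq: "G = extend_plan (upper_left_block G)" and v: "upper_left_block G \<in> couplings a b"
        using slack_eq_0D[OF _ assms(2,4)] that by (auto simp: K_def)
      have "upper_left_block G \<noteq> w" using eq that(3) by auto
      \<comment> \<open>On block diagonal plans \<open>g\<close> is the balanced objective minus
        \<open>\<epsilon>\<close>, so the strict minimality of \<open>w\<close> carries
        over.\<close>
      then show ?thesis using w_min[OF v] unfolding g_def
        by (subst (1 2) eq)
          (simp add: transport_cost_extend_plan entropy_extend_plan algebra_simps)
    qed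
  qed (use P P_min in auto)
  then have "((\<lambda>l. P l $ Some i $ Some j) \<longlongrightarrow> w $ i $ j) at_top" for i j
    using tendsto_vec_nth[OF tendsto_vec_nth, of P "extend_plan w" at_top "Some i" "Some j"]
    by simp
  \<comment> \<open>Entrywise convergence suffices, since the \<ell>1 norm is a finite sum.\<close>
  then have "((\<lambda>l. \<Sum>i\<in>UNIV. \<Sum>j\<in>UNIV. \<bar>P l $ Some i $ Some j - w $ i $ j\<bar>)
      \<longlongrightarrow> (\<Sum>i\<in>(UNIV::'n set). \<Sum>j\<in>(UNIV::'m set). \<bar>w $ i $ j - w $ i $ j\<bar>)) at_top"
    by (intro tendsto_intros)
  then show ?thesis by (simp add: l1_norm_def upper_left_block_def P_def w_def)
qed

end
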